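(* For any $k\in\mathbb{N}$, $\rho_k^1=1+2\pi$.
   Context: Let $\mathcal{C}$ be the unit circle in the Euclidean plane centered at the origin. For $n,k\in\mathbb{N}$, $k$ treasures are hidden at unknown points $\mathbf{T}=(T_1,\dots,T_k)\in\mathcal{C}^k$, and $n$ robots start at time $0$ at the origin. Each robot moves independently anywhere in the plane (not restricted to $\mathcal{C}$) with speed at most $1$. A treasure is discovered when the position of some robot coincides with it; upon discovery all robots instantly learn its location. A strategy specifies the motion of all $n$ robots, where at each time the motion may depend only on the information about treasures discovered so far; $\mathcal{S}_k^n$ is the set of all valid strategies for $n$ robots and $k$ treasures. For $S\in\mathcal{S}_k^n$ let $\rho_S(\mathbf{T})$ be the time required until every robot has individually visited (been at the location of) every treasure. Define $$\rho_k^n=\inf_{S\in\mathcal{S}_k^n}\ \sup_{\mathbf{T}\in\mathcal{C}^k}\rho_S(\mathbf{T}).$$ Thus $\rho_k^1$ is the case of a single robot and $k$ treasures. *)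

theory Defs
  imports "HOL-Analysis.Analysis"
begin

text \<open>
  The Euclidean plane is \<open>complex\<close>. Robots are indexed by \<open>i < n\<close>, treasures by \<open>j < k\<close>,
  and only times \<open>t \<ge> 0\<close> matter.
\<close>

type_synonym motion = "nat \<Rightarrow> real \<Rightarrow> complex"

definition unit_circle :: "complex set" where
  "unit_circle = sphere 0 1"

text \<open>The product of \<open>k\<close> copies of the circle; treasures may coincide.\<close>

definition placements :: "nat \<Rightarrow> (nat \<Rightarrow> complex) set" where
  "placements k = ({..<k} \<rightarrow>\<^sub>E unit_circle)"

definition visited_by :: "(real \<Rightarrow> complex) \<Rightarrow> real \<Rightarrow> complex \<Rightarrow> bool" where
  "visited_by p t x \<longleftrightarrow> (\<exists>s\<in>{0..t}. p s = x)"

definition discovered :: "nat \<Rightarrow> motion \<Rightarrow> real \<Rightarrow> complex \<Rightarrow> bool" where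
  "discovered n m t x \<longleftrightarrow> (\<exists>i<n. visited_by (m i) t x)"

text \<open>What all robots know at time \<open>t\<close>: which treasures have been found, and where these are.\<close>

definition known ::
    "nat \<Rightarrow> nat \<Rightarrow> motion \<Rightarrow> (nat \<Rightarrow> complex) \<Rightarrow> real \<Rightarrow> nat \<Rightarrow> complex option" where
  "known n k m T t = (\<lambda>j. if j < k \<and> discovered n m t (T j) then Some (T j) else None)"

definition admissible_motion :: "nat \<Rightarrow> motion \<Rightarrow> bool" where
  "admissible_motion n m \<longleftrightarrow> (\<forall>i<n. m i 0 = 0 \<and> 1-lipschitz_on {0..} (m i))"

text \<open>
  A strategy is given by the motions it produces, \<open>S T i t\<close> being the position of robot \<open>i\<close> at
  time \<open>t\<close> if the treasures are at \<open>T\<close>. The last conjunct says that the positions at time \<open>t\<close>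
  are a function of the history of the robots' knowledge up to time \<open>t\<close>.
  It does not allow anticipation: positions are continuous in time and there are finitely many
  treasures, so the runs for two placements can only separate after a time at which one of them
  discovers a treasure that the other does not discover at that place and time.
\<close>

definition strategies :: "nat \<Rightarrow> nat \<Rightarrow> ((nat \<Rightarrow> complex) \<Rightarrow> motion) set" where
  "strategies n k = {S.
     (\<forall>T\<in>placements k. admissible_motion n (S T)) \<and>
     (\<forall>T\<in>placements k. \<forall>T'\<in>placements k. \<forall>t\<ge>0.
        (\<forall>s\<in>{0..t}. known n k (S T) T s = known n k (S T') T' s) \<longrightarrow>
        (\<forall>i<n. S T i t = S T' i t))}"

text \<open>This is \<open>\<infinity>\<close> if some robot never visits some treasure.\<close>

definition completion_time :: "nat \<Rightarrow> nat \<Rightarrow> motion \<Rightarrow> (nat \<Rightarrow> complex) \<Rightarrow> ereal" where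
  "completion_time n k m T =
     Inf (ereal ` {t. 0 \<le> t \<and> (\<forall>i<n. \<forall>j<k. visited_by (m i) t (T j))})"

definition rho :: "nat \<Rightarrow> nat \<Rightarrow> ereal" where
  "rho n k = (INF S\<in>strategies n k. SUP T\<in>placements k. completion_time n k (S T) T)"

end

theory Submission
  imports Defs "HOL-Real_Asymp.Real_Asymp"
begin

text \<open>
  For the upper bound, walk to the circle and then once around it. For the lower bound, put all
  treasures at one point \<open>x\<close> and let \<open>\<tau> x\<close> be the time at which the robot first reaches \<open>x\<close>.
  Until the earlier of \<open>\<tau> x\<close> and \<open>\<tau> y\<close> the runs for \<open>x\<close> and \<open>y\<close> agree, so
  \<open>dist x y \<le> \<bar>\<tau> x - \<tau> y\<bar>\<close>. Hence the discovery times of the vertices of a regular \<open>N\<close>-gon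
  are pairwise at least a side length \<open>2 sin (\<pi>/N)\<close> apart. None is below \<open>1\<close>, so the last one is
  at least \<open>1 + (N - 1) 2 sin (\<pi>/N)\<close>, which tends to \<open>1 + 2\<pi>\<close>.
\<close>

section \<open>Chords of the unit circle and regular polygons\<close>

lemma dist_cis: "dist (cis a) (cis b) = 2 * \<bar>sin ((a - b) / 2)\<bar>"
proof -
  have "(dist (cis a) (cis b))\<^sup>2 = (cos a - cos b)\<^sup>2 + (sin a - sin b)\<^sup>2"
    by (simp add: dist_norm cmod_power2)
  also have "\<dots> = ((sin a)\<^sup>2 + (cos a)\<^sup>2) + ((sin b)\<^sup>2 + (cos b)\<^sup>2) - 2 * (cos a * cos b + sin a * sin b)"
    by (simp add: power2_eq_square algebra_simps)
  also have "\<dots> = 2 - 2 * cos (a - b)"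
    by (simp add: cos_diff)
  also have "a - b = 2 * ((a - b) / 2)"
    by simp
  also have "2 - 2 * cos \<dots> = 2 - 2 * (1 - 2 * (sin ((a - b) / 2))\<^sup>2)"
    by (simp only: cos_double_sin)
  also have "\<dots> = (2 * \<bar>sin ((a - b) / 2)\<bar>)\<^sup>2"
    by (simp add: power_mult_distrib)
  finally show ?thesis
    by (rule power2_eq_imp_eq) auto
qed

lemma dist_cis_le: "dist (cis a) (cis b) \<le> \<bar>a - b\<bar>"
  using abs_sin_x_le_abs_x[of "(a - b) / 2"] by (simp add: dist_cis)

text \<open>A chord spanning \<open>m\<close> edges has length \<open>2 * sin (pi * m / N)\<close>
  with \<open>1 \<le> m \<le> N - 1\<close>. On this range sine is smallest at the two ends, so the
  shortest chords are the sides.\<close>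

lemma dist_regular_polygon_ge:
  fixes N i j :: nat
  assumes "i < N" "j < N" "i \<noteq> j"
  shows "2 * sin (pi / N) \<le> dist (cis (2 * pi * i / N)) (cis (2 * pi * j / N))"
proof -
  have *: "2 * sin (pi / N) \<le> dist (cis (2 * pi * i / N)) (cis (2 * pi * j / N))"
    if "j < i" "i < N" for i j
  proof -
    define m where "m = i - j"
    have m: "1 \<le> m" "m + 1 \<le> N" and N: "0 < N" and "2 \<le> N"
      using that by (auto simp: m_def)
    have half: "(2 * pi * i / N - 2 * pi * j / N) / 2 = pi * m / N"
      using that N by (simp add: m_def of_nat_diff field_simps)
    have "sin (pi / N) \<le> sin (pi * m / N)"
    proof (cases "2 * m \<le> N")
      case True
      have "2 * real m \<le> real N" using True by linarith
      then have "pi * m / N \<le> pi / 2"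
        using N mult_left_mono[of "2 * real m" "real N" pi] by (simp add: field_simps)
      moreover have "pi / N \<le> pi * m / N"
        using m by (intro divide_right_mono) auto
      moreover have "0 \<le> pi / N" by simp
      ultimately show ?thesis
        by (intro sin_monotone_2pi_le) (use pi_gt_zero in linarith)+
    next
      case False
      \<comment> \<open>Counted the other way round, the same chord spans \<open>N - m\<close>
        edges; this brings the angle back to at most \<open>pi / 2\<close>, where sine
        increases.\<close>
      have refl: "sin (pi * m / N) = sin (pi * (N - m) / N)"
      proof -
        have "pi * real (N - m) / N = pi - pi * m / N"
          using m N by (simp add: of_nat_diff field_simps)
        then show ?thesis by simp
      qed
      have "2 * real (N - m) \<le> real N" using False by linarith
      then have "pi * real (N - m) / N \<le> pi / 2"
        using N mult_left_mono[of "2 * real (N - m)" "real N" pi] by (simp add: field_simps)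
      moreover have "pi / N \<le> pi * real (N - m) / N"
        using m by (intro divide_right_mono) auto
      moreover have "0 \<le> pi / N" by simp
      ultimately show ?thesis unfolding refl
        by (intro sin_monotone_2pi_le) (use pi_gt_zero in linarith)+
    qed
    then show ?thesis unfolding dist_cis half by linarith
  qed
  show ?thesis
    using *[of j i] *[of i j] assms by (cases "j < i") (auto simp: dist_commute)
qed

section \<open>Separated sets of reals, and first visits along a path\<close>

text \<open>Removing the largest element \<open>c\<close> leaves a set inside
  \<open>{a..c - d}\<close>, so every element beyond the first costs a length of \<open>d\<close>.
  The right end changes along the way, hence the induction with \<open>b\<close> arbitrary.\<close>

lemma separated_card_le:
  fixes A :: "real set"
  assumes "finite A" "A \<noteq> {}" "A \<subseteq> {a..b}"
    and "\<And>x y. x \<in> A \<Longrightarrow> y \<in> A \<Longrightarrow> x \<noteq> y \<Longrightarrow> d \<le> \<bar>x - y\<bar>"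
  shows "(real (card A) - 1) * d \<le> b - a"
  using assms
proof (induction A arbitrary: b rule: finite_linorder_max_induct)
  case empty
  then show ?case by simp
next
  case (insert c A)
  show ?case
  proof (cases "A = {}")
    case True
    with insert show ?thesis by auto
  next
    case False
    have "A \<subseteq> {a..c - d}"
    proof
      fix x assume x: "x \<in> A"
      have "d \<le> \<bar>x - c\<bar>" using insert.prems(3)[of x c] insert.hyps x by force
      then show "x \<in> {a..c - d}" using insert.hyps insert.prems(2) x by force
    qed
    then have "(real (card A) - 1) * d \<le> (c - d) - a"
      using insert.IH[of "c - d"] False insert.prems(3) by auto
    moreover have "card (insert c A) = card A + 1" using insert.hyps by auto
    moreover have "c \<le> b" using insert.prems(2) by auto
    ultimately show ?thesis by (simp add: algebra_simps)
  qed
qed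

text \<open>The times in \<open>{0..c}\<close> spent at \<open>x\<close> form a nonempty compact
  set, which has a least element.\<close>

lemma first_visit:
  fixes p :: "real \<Rightarrow> complex"
  assumes "continuous_on {0..} p" "visited_by p c x"
  obtains t where "0 \<le> t" "t \<le> c" "p t = x" "\<And>s. s < t \<Longrightarrow> \<not> visited_by p s x"
proof -
  define V where "V = {t \<in> {0..c}. p t = x}"
  have "closed V" unfolding V_def
    by (intro continuous_closed_preimage_constant continuous_on_subset[OF assms(1)]) auto
  moreover have "bounded V"
    by (rule bounded_subset[of "{0..c}"]) (auto simp: V_def)
  ultimately have "compact V" by (simp add: compact_eq_bounded_closed)
  moreover have "V \<noteq> {}" using assms(2) by (auto simp: V_def visited_by_def)
  ultimately obtain t where t: "t \<in> V" "\<And>s. s \<in> V \<Longrightarrow> t \<le> s"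
    using compact_attains_inf[of V] by metis
  show ?thesis
  proof (rule that)
    show "0 \<le> t" "t \<le> c" "p t = x" using t(1) by (auto simp: V_def)
    show "\<not> visited_by p s x" if "s < t" for s
      using t that by (force simp: V_def visited_by_def)
  qed
qed

text \<open>Two runs with equal knowledge are known to coincide only before the first discovery;
  continuity extends this to the moment of discovery itself.\<close>

lemma lipschitz_agree_at_endpoint:
  fixes p q :: "real \<Rightarrow> complex"
  assumes "1-lipschitz_on {0..} p" "1-lipschitz_on {0..} q" "0 < t"
    and eq: "\<And>s. 0 \<le> s \<Longrightarrow> s < t \<Longrightarrow> p s = q s"
  shows "p t = q t"
proof (rule ccontr)
  assume "p t \<noteq> q t"
  then have pos: "0 < dist (p t) (q t)" by simp
  \<comment> \<open>From \<open>s\<close> to \<open>t\<close> each path moves at most a quarter of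
    the supposed gap, so together they cannot open more than half of it. The maximum keeps
    \<open>s\<close> nonnegative.\<close>
  define s where "s = max 0 (t - dist (p t) (q t) / 4)"
  have s: "0 \<le> s" "s < t" "t - s \<le> dist (p t) (q t) / 4"
    unfolding s_def using pos assms(3) by linarith+
  have "dist (p t) (p s) \<le> t - s" "dist (q t) (q s) \<le> t - s"
    using lipschitz_onD[OF assms(1), of t s] lipschitz_onD[OF assms(2), of t s] s
    by (auto simp: dist_real_def)
  moreover have "dist (p t) (q t) \<le> dist (p t) (p s) + dist (q t) (q s)"
    using dist_triangle2[of "p t" "q t" "p s"] eq[OF s(1,2)] by simp
  ultimately show False using s(3) pos by linarith
qed

section \<open>Upper bound: one tour of the circle\<close>

definition circle_walk :: "real \<Rightarrow> complex" where
  "circle_walk t = (if t \<le> 1 then of_real t else cis (t - 1))"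

lemma circle_walk_0: "circle_walk 0 = 0"
  by (simp add: circle_walk_def)

lemma dist_circle_walk_le:
  assumes "s \<le> t"
  shows "dist (circle_walk s) (circle_walk t) \<le> t - s"
proof -
  have radial: "dist (complex_of_real a) (complex_of_real b) \<le> \<bar>a - b\<bar>" for a b
    by (simp add: dist_real_def)
  consider "t \<le> 1" | "s \<le> 1" "1 < t" | "1 < s" by linarith
  then show ?thesis
  proof cases
    case 1
    then show ?thesis using assms radial[of s t] by (simp add: circle_walk_def)
  next
    case 2
    \<comment> \<open>Triangle inequality through the point \<open>1 = cis 0\<close>, where the
      radius meets the arc.\<close>
    have "dist (complex_of_real s) (cis (t - 1)) \<le> dist (complex_of_real s) 1 + dist (cis 0) (cis (t - 1))"
      using dist_triangle[of "complex_of_real s" "cis (t - 1)" 1] by simp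
    also have "\<dots> \<le> \<bar>s - 1\<bar> + \<bar>0 - (t - 1)\<bar>"
      using radial[of s 1] by (intro add_mono dist_cis_le) simp
    finally show ?thesis using 2 by (simp add: circle_walk_def)
  next
    case 3
    then show ?thesis using assms dist_cis_le[of "s - 1" "t - 1"] by (simp add: circle_walk_def)
  qed
qed

lemma lipschitz_circle_walk: "1-lipschitz_on X circle_walk"
proof (rule lipschitz_onI)
  show "dist (circle_walk s) (circle_walk t) \<le> 1 * dist s t" for s t
    using dist_circle_walk_le[of s t] dist_circle_walk_le[of t s]
    by (cases "s \<le> t") (auto simp: dist_real_def dist_commute)
qed simp

lemma circle_walk_visits:
  assumes "x \<in> unit_circle"
  shows "visited_by circle_walk (1 + 2 * pi) x"
proof -
  have "cmod x = 1" using assms by (simp add: unit_circle_def)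
  then obtain \<theta> where \<theta>: "0 \<le> \<theta>" "\<theta> < 2 * pi" "x = cis \<theta>"
    using complex_unimodular_polar[of x] by (metis cis.ctr)
  have "circle_walk (1 + \<theta>) = x" using \<theta> by (auto simp: circle_walk_def)
  then show ?thesis using \<theta> by (auto simp: visited_by_def intro!: bexI[of _ "1 + \<theta>"])
qed

lemma rho_single_le: "rho 1 k \<le> ereal (1 + 2 * pi)"
proof -
  \<comment> \<open>This strategy ignores all information, so its motions do not depend on the
    placement and cannot anticipate.\<close>
  define S :: "(nat \<Rightarrow> complex) \<Rightarrow> motion" where "S = (\<lambda>_ _. circle_walk)"
  have "S \<in> strategies 1 k"
    using lipschitz_circle_walk circle_walk_0
    by (simp add: strategies_def S_def admissible_motion_def)
  then have "rho 1 k \<le> (SUP T\<in>placements k. completion_time 1 k (S T) T)"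
    unfolding rho_def by (rule INF_lower)
  also have "\<dots> \<le> ereal (1 + 2 * pi)"
  proof (rule SUP_least)
    fix T assume T: "T \<in> placements k"
    have "visited_by circle_walk (1 + 2 * pi) (T j)" if "j < k" for j
      using T that by (intro circle_walk_visits) (auto simp: placements_def)
    then show "completion_time 1 k (S T) T \<le> ereal (1 + 2 * pi)"
      unfolding completion_time_def by (intro Inf_lower imageI) (auto simp: S_def)
  qed
  finally show ?thesis .
qed

section \<open>Lower bound: all treasures at one point\<close>

text \<open>Here \<open>c\<close> is a deadline met for every common location \<open>x\<close> of
  the treasures. The polygon argument forces the first visits far enough apart that some deadline
  would be missed if \<open>c\<close> were smaller.\<close>

lemma strategy_visits_slowly:
  fixes k :: nat
  assumes S: "S \<in> strategies 1 k"
    and vis: "\<And>x. x \<in> unit_circle \<Longrightarrow> visited_by (S (\<lambda>j\<in>{..<k}. x) 0) c x"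
  shows "1 + 2 * pi \<le> c"
proof -
  define p where "p x = S (\<lambda>j\<in>{..<k}. x) 0" for x
  have place: "(\<lambda>j\<in>{..<k}. x) \<in> placements k" if "x \<in> unit_circle" for x
    using that by (auto simp: placements_def)
  have adm: "p x 0 = 0" "1-lipschitz_on {0..} (p x)" if "x \<in> unit_circle" for x
  proof -
    have "admissible_motion 1 (S (\<lambda>j\<in>{..<k}. x))"
      using S place[OF that] unfolding strategies_def by blast
    then show "p x 0 = 0" "1-lipschitz_on {0..} (p x)"
      by (simp_all add: admissible_motion_def p_def)
  qed
  have "\<forall>x\<in>unit_circle. \<exists>t. 0 \<le> t \<and> t \<le> c \<and> p x t = x \<and> (\<forall>s<t. \<not> visited_by (p x) s x)"
    by (metis first_visit adm(2) lipschitz_on_continuous_on vis p_def)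
  then obtain \<tau> where \<tau>: "\<And>x. x \<in> unit_circle \<Longrightarrow>
      0 \<le> \<tau> x \<and> \<tau> x \<le> c \<and> p x (\<tau> x) = x \<and> (\<forall>s<\<tau> x. \<not> visited_by (p x) s x)"
    by metis
  have \<tau>_ge: "1 \<le> \<tau> x" if x: "x \<in> unit_circle" for x
  proof -
    have "dist (p x (\<tau> x)) (p x 0) \<le> 1 * dist (\<tau> x) 0"
      using \<tau>[OF x] by (intro lipschitz_onD[OF adm(2)[OF x]]) auto
    then show ?thesis using x \<tau>[OF x] adm(1)[OF x] by (simp add: unit_circle_def)
  qed
  have sep: "dist x y \<le> \<tau> y - \<tau> x"
    if x: "x \<in> unit_circle" and y: "y \<in> unit_circle" and le: "\<tau> x \<le> \<tau> y" for x y
  proof -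
    have agree: "p x t = p y t" if t: "0 \<le> t" "t < \<tau> x" for t
    proof -
      \<comment> \<open>Before \<open>\<tau> x \<le> \<tau> y\<close> neither run has found
        anything, so the knowledge is \<open>None\<close> for every treasure in both.\<close>
      have "known 1 k (S (\<lambda>j\<in>{..<k}. x)) (\<lambda>j\<in>{..<k}. x) s = known 1 k (S (\<lambda>j\<in>{..<k}. y)) (\<lambda>j\<in>{..<k}. y) s"
        if "s \<in> {0..t}" for s
        using that t \<tau>[OF x] \<tau>[OF y] le by (auto simp: known_def discovered_def fun_eq_iff p_def)
      moreover have "\<forall>T\<in>placements k. \<forall>T'\<in>placements k. \<forall>t\<ge>0.
          (\<forall>s\<in>{0..t}. known 1 k (S T) T s = known 1 k (S T') T' s) \<longrightarrow> (\<forall>i<1. S T i t = S T' i t)"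
        using S unfolding strategies_def by (elim CollectE conjE)
      ultimately show ?thesis
        using place[OF x] place[OF y] t(1) unfolding p_def by (metis zero_less_one)
    qed
    have "p x (\<tau> x) = p y (\<tau> x)"
    proof (rule lipschitz_agree_at_endpoint[OF adm(2)[OF x] adm(2)[OF y] _ agree])
      show "0 < \<tau> x" using \<tau>_ge[OF x] by linarith
    qed
    \<comment> \<open>The run for \<open>y\<close> itself passes through \<open>x\<close> at time
      \<open>\<tau> x\<close> and must still reach \<open>y\<close> at time \<open>\<tau> y\<close>,
      with speed at most 1.\<close>
    then have "dist x y = dist (p y (\<tau> x)) (p y (\<tau> y))"
      using \<tau>[OF x] \<tau>[OF y] by simp
    also have "\<dots> \<le> 1 * dist (\<tau> x) (\<tau> y)"
      using \<tau>[OF x] \<tau>[OF y] by (intro lipschitz_onD[OF adm(2)[OF y]]) auto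
    finally show ?thesis using le by (simp add: dist_real_def)
  qed
  then have sep: "dist x y \<le> \<bar>\<tau> x - \<tau> y\<bar>" if "x \<in> unit_circle" "y \<in> unit_circle" for x y
    using that by (metis abs_ge_self abs_minus_commute dist_commute linear order_trans)
  have bound: "(real N - 1) * (2 * sin (pi / N)) \<le> c - 1" if N: "0 < N" for N :: nat
  proof -
    define v where "v i = cis (2 * pi * real i / N)" for i
    have v: "v i \<in> unit_circle" for i by (simp add: v_def unit_circle_def)
    have gap: "2 * sin (pi / N) \<le> \<bar>\<tau> (v i) - \<tau> (v j)\<bar>" if "i < N" "j < N" "i \<noteq> j" for i j
      using dist_regular_polygon_ge[OF that] sep[OF v v, of i j] unfolding v_def by linarith
    show ?thesis
    \<comment> \<open>For \<open>N = 1\<close> the number \<open>sin pi\<close> is 0 and gives no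
      positive gap; the claim is then just \<open>1 \<le> c\<close>.\<close>
    proof (cases "N = 1")
      case True
      then show ?thesis using \<tau>[OF v[of 0]] \<tau>_ge[OF v[of 0]] by simp
    next
      case False
      have "pi / N < pi" using False N by (simp add: field_simps)
      then have "0 < sin (pi / N)" using N by (intro sin_gt_zero) auto
      \<comment> \<open>A positive gap keeps the discovery times distinct, so their set really has
        \<open>N\<close> elements.\<close>
      then have inj: "inj_on (\<lambda>i. \<tau> (v i)) {..<N}"
        using gap by (force intro!: inj_onI)
      have "(real (card ((\<lambda>i. \<tau> (v i)) ` {..<N})) - 1) * (2 * sin (pi / N)) \<le> c - 1"
        using N \<tau>[OF v] \<tau>_ge[OF v] by (intro separated_card_le) (auto intro: gap)
      then show ?thesis by (simp add: card_image[OF inj])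
    qed
  qed
  have "(\<lambda>N::nat. (real N - 1) * (2 * sin (pi / N))) \<longlonglongrightarrow> 2 * pi"
    by real_asymp
  then have "2 * pi \<le> c - 1"
    using bound by (intro LIMSEQ_le_const2) (auto intro!: exI[of _ 1])
  then show ?thesis by simp
qed

theorem mainTheorem5:
  fixes k :: nat
  assumes "k \<ge> 1"
  shows "rho 1 k = ereal (1 + 2 * pi)"
proof (rule antisym)
  show "rho 1 k \<le> ereal (1 + 2 * pi)" by (rule rho_single_le)
  show "ereal (1 + 2 * pi) \<le> rho 1 k"
    unfolding rho_def
  proof (rule INF_greatest, rule ccontr)
    fix S assume S: "S \<in> strategies 1 k"
    assume "\<not> ereal (1 + 2 * pi) \<le> (SUP T\<in>placements k. completion_time 1 k (S T) T)"
    then have "(SUP T\<in>placements k. completion_time 1 k (S T) T) < ereal (1 + 2 * pi)"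
      by (simp only: not_le)
    \<comment> \<open>A real \<open>c\<close> strictly above the supremum is a deadline common to
      all placements: each infimum below \<open>c\<close> is witnessed by an actual time before
      \<open>c\<close>, even if the infimum itself were not attained.\<close>
    from ereal_dense2[OF this] obtain c
      where c: "(SUP T\<in>placements k. completion_time 1 k (S T) T) < ereal c"
        "ereal c < ereal (1 + 2 * pi)"
      by (elim exE conjE)
    have "visited_by (S (\<lambda>j\<in>{..<k}. x) 0) c x" if x: "x \<in> unit_circle" for x
    proof -
      define T where "T = (\<lambda>j\<in>{..<k}. x)"
      have "T \<in> placements k" using x by (auto simp: placements_def T_def)
      then have "completion_time 1 k (S T) T < ereal c"
        by (rule le_less_trans[OF SUP_upper c(1)])
      then obtain t where "t < c" "\<forall>j<k. visited_by (S T 0) t (T j)"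
        unfolding completion_time_def Inf_less_iff by auto
      \<comment> \<open>At least one treasure is required for the robot to be forced to visit
        \<open>x\<close>.\<close>
      moreover have "0 < k" using assms by simp
      ultimately have "visited_by (S T 0) t x" by (auto simp: T_def)
      with \<open>t < c\<close> show ?thesis
        unfolding visited_by_def T_def by (meson atLeastAtMost_iff less_imp_le order_trans)
    qed
    then have "1 + 2 * pi \<le> c" by (rule strategy_visits_slowly[OF S])
    with c(2) show False by simp
  qed
qed

end
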